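(* Let $\widehat{P}$ be a closed self-replicating subgroup of $\mathrm{Isom}(T_{q,q})$. Then there is a scale group $P\in \mathrm{Sc}(q+1)$ such that the standard labelling of $T_{q+1}$ is compatible with $P$ and $\widehat{P} = P|_{\mathbf{v}}$ for every vertex $\mathbf{v}$ of $T_{q+1}$, where $P|_{\mathbf{v}} = \{x|_{\mathbf{v}} \mid x\in P\}$.
   Context: Let $q\ge 2$ be an integer. For a tree $T$, $\mathrm{Isom}(T)$ is its automorphism group (for a rooted tree, automorphisms fix the root), with the topology of pointwise convergence on vertices; $G_{\mathbf v}$ denotes the stabiliser of a vertex $\mathbf v$. An end of a tree is an equivalence class of rays, two rays being equivalent if they share infinitely many vertices. The regular tree $T_{q+1}$ is the following graph. For $n\in\mathbb{Z}$, $\mathcal{V}_n$ is the set of strings $\mathbf{w}=(w_i)_{i\le n}$ with $w_i\in\{0,\dots,q-1\}$ and $w_i=0$ for all but finitely many $i$. The vertex set is $\bigcup_{n\in\mathbb Z}\mathcal{V}_n$. For $\mathbf{w}\in\mathcal{V}_n$, $\mathbf{w}^+\in\mathcal{V}_{n-1}$ is obtained by deleting the last term, and for $j\in\{0,\dots,q-1\}$, $\mathbf{w}j\in\mathcal{V}_{n+1}$ is obtained by appending $j$. The edges are the pairs $\{\mathbf{w},\mathbf{w}^+\}$. Every ray $\mathbf w,\mathbf w^+,\mathbf w^{++},\dots$ belongs to one and the same end, denoted $\omega$. For a vertex $\mathbf{v}$, $T_{\mathbf v}$ is the component containing $\mathbf v$ of the graph obtained by deleting the edge $\{\mathbf v,\mathbf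 v^+\}$, i.e. it is spanned by all strings extending $\mathbf v$ by finitely many further symbols. A scale group is a closed subgroup of $\mathrm{Isom}(T_{q+1})$ that fixes $\omega$ and is transitive on vertices; $\mathrm{Sc}(q+1)$ is the set of scale groups. The standard labelling assigns to each directed edge a label: $c_{\mathbf v}(\mathbf v,\mathbf v j)=j$ for $j\in\{0,\dots,q-1\}$ and $c_{\mathbf v}(\mathbf v,\mathbf v^+)=q$. It is compatible with $P$ if for all vertices $\mathbf u_1,\mathbf u_2$ there is $x\in P$ with $x.\mathbf u_1=\mathbf u_2$ such that $c_{x.\mathbf a}(x.\mathbf a,x.\mathbf b)=c_{\mathbf a}(\mathbf a,\mathbf b)$ for every directed edge $(\mathbf a,\mathbf b)$ of $T_{\mathbf u_1}$. (The other two requirements for a compatible labelling, that edges towards $\omega$ are labelled $q$ and that there is a bi-infinite path $(\mathbf v_n)$ with $\mathbf v_n=\mathbf v_{n+1}^+$ all of whose edges $(\mathbf v_n,\mathbf v_{n+1})$ are labelled $0$, hold automatically for the standard labelling.) $T_{q,q}$ is the rooted tree whose vertices are the finite strings in $\{0,\dots,q-1\}$, with root the empty string and with each $\mathbf w$ having the children $\mathbf wj$, $j\in\{0,\dots,q-1\}$; level $n$ is the set of strings of length $n$. For $\mathbf v$ a vertex of $T_{q+1}$, $\phi_{\mathbf v}:T_{\mathbf v}\to T_{q,q}$ is the isomorphism $\mathbf v v_{n+1}\dots v_m\mapsto v_{n+1}\dots v_m$. For $g\in\mathrm{Isom}(T_{q+1})$ fixing $\omega$, the section of $g$ at $\mathbf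 v$ is $g|_{\mathbf v}=\phi_{g.\mathbf v}\circ g\circ\phi_{\mathbf v}^{-1}\in\mathrm{Isom}(T_{q,q})$. For $g\in\mathrm{Isom}(T_{q,q})$ and a vertex $\mathbf w$ of $T_{q,q}$, the section $g|_{\mathbf w}\in\mathrm{Isom}(T_{q,q})$ is defined by $g.(\mathbf w\mathbf u)=(g.\mathbf w)(g|_{\mathbf w}.\mathbf u)$ for all finite strings $\mathbf u$. A subgroup $G\le\mathrm{Isom}(T_{q,q})$ is self-similar if $g|_{\mathbf w}\in G$ for all $g\in G$ and all vertices $\mathbf w$. A self-similar $G$ is self-replicating if it is transitive on level $1$ and for every vertex $\mathbf w$ the map $g\mapsto g|_{\mathbf w}$, $G_{\mathbf w}\to G$, is surjective. *)

theory Defs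
  imports "HOL-Analysis.Analysis" "HOL-Algebra.Bij"
begin

section \<open>Graphs, automorphisms, ends\<close>

text \<open>A graph is a pair of a vertex set \<open>V\<close> and a set \<open>E\<close> of unordered edges.  Automorphisms are
  bijections of \<open>V\<close>, extended by \<open>undefined\<close> outside \<open>V\<close> as in \<open>HOL-Algebra.Bij\<close>; this agrees with
  the convention of \<open>product_topology\<close>.\<close>

definition isom :: "'a set \<Rightarrow> 'a set set \<Rightarrow> ('a \<Rightarrow> 'a) set" where
  "isom V E = {g \<in> Bij V. \<forall>a\<in>V. \<forall>b\<in>V. {g a, g b} \<in> E \<longleftrightarrow> {a, b} \<in> E}"

definition group_on :: "'a set \<Rightarrow> ('a \<Rightarrow> 'a) set \<Rightarrow> ('a \<Rightarrow> 'a) monoid" where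
  "group_on V A = BijGroup V \<lparr>carrier := A\<rparr>"

definition pointwise_topology :: "'a set \<Rightarrow> ('a \<Rightarrow> 'a) set \<Rightarrow> ('a \<Rightarrow> 'a) topology" where
  "pointwise_topology V A = subtopology (product_topology (\<lambda>_. discrete_topology V) V) A"

definition component :: "'a set set \<Rightarrow> 'a \<Rightarrow> 'a set" where
  "component E v = {u. (v, u) \<in> {(a, b). {a, b} \<in> E}\<^sup>*}"

definition rays :: "'a set \<Rightarrow> 'a set set \<Rightarrow> (nat \<Rightarrow> 'a) set" where
  "rays V E = {r. inj r \<and> range r \<subseteq> V \<and> (\<forall>i. {r i, r (Suc i)} \<in> E)}"

definition end_rel :: "'a set \<Rightarrow> 'a set set \<Rightarrow> ((nat \<Rightarrow> 'a) \<times> (nat \<Rightarrow> 'a)) set" where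
  "end_rel V E = {(r, s). r \<in> rays V E \<and> s \<in> rays V E \<and> infinite (range r \<inter> range s)}"

definition fixes_end :: "('a \<Rightarrow> 'a) \<Rightarrow> (nat \<Rightarrow> 'a) set \<Rightarrow> bool" where
  "fixes_end g e \<longleftrightarrow> (\<lambda>r. g \<circ> r) ` e = e"

section \<open>The regular tree\<close>

text \<open>The string \<open>(w\<^sub>i)\<close>, \<open>i \<le> n\<close>, is the pair \<open>(n, w)\<close>, where \<open>w\<close> is \<open>undefined\<close> at all \<open>i > n\<close>.\<close>

type_synonym vertex = "int \<times> (int \<Rightarrow> nat)"

definition verts :: "nat \<Rightarrow> vertex set" where
  "verts q = {(n, w). w \<in> {..n} \<rightarrow>\<^sub>E {..<q} \<and> finite {i. i \<le> n \<and> w i \<noteq> 0}}"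

fun parent :: "vertex \<Rightarrow> vertex" where
  "parent (n, w) = (n - 1, restrict w {..n - 1})"

fun child :: "vertex \<Rightarrow> nat \<Rightarrow> vertex" where
  "child (n, w) j = (n + 1, w(n + 1 := j))"

definition edges :: "nat \<Rightarrow> vertex set set" where
  "edges q = {{v, parent v} | v. v \<in> verts q}"

definition parent_ray :: "vertex \<Rightarrow> nat \<Rightarrow> vertex" where
  "parent_ray v k = (parent ^^ k) v"

text \<open>The end \<open>\<omega>\<close> is the class of the ray starting at the zero string in \<open>\<V>\<^sub>0\<close>; by
  \<open>parent_ray_in_omega\<close> below the starting vertex does not matter.\<close>

definition omega :: "nat \<Rightarrow> (nat \<Rightarrow> vertex) set" where
  "omega q = end_rel (verts q) (edges q) `` {parent_ray (0, restrict (\<lambda>_. 0) {..0})}"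

definition subtree :: "nat \<Rightarrow> vertex \<Rightarrow> vertex set" where
  "subtree q v = component (edges q - {{v, parent v}}) v"

abbreviation isom_reg :: "nat \<Rightarrow> (vertex \<Rightarrow> vertex) set" where
  "isom_reg q \<equiv> isom (verts q) (edges q)"

text \<open>\<open>scale_groups q\<close> is \<open>Sc(q+1)\<close>.\<close>

definition scale_groups :: "nat \<Rightarrow> (vertex \<Rightarrow> vertex) set set" where
  "scale_groups q = {P.
     subgroup P (group_on (verts q) (isom_reg q)) \<and>
     closedin (pointwise_topology (verts q) (isom_reg q)) P \<and>
     (\<forall>x\<in>P. fixes_end x (omega q)) \<and>
     (\<forall>u\<in>verts q. \<forall>v\<in>verts q. \<exists>x\<in>P. x u = v)}"

text \<open>A labelling \<open>c\<close> is applied to directed edges: \<open>c a b\<close> is the label \<open>c\<^sub>a(a, b)\<close>.  The last symbol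
  of \<open>(n, w)\<close> is \<open>w n\<close>.\<close>

definition std_label :: "nat \<Rightarrow> vertex \<Rightarrow> vertex \<Rightarrow> nat" where
  "std_label q a b = (if b = parent a then q else snd b (fst b))"

definition compatible :: "nat \<Rightarrow> (vertex \<Rightarrow> vertex \<Rightarrow> nat) \<Rightarrow> (vertex \<Rightarrow> vertex) set \<Rightarrow> bool" where
  "compatible q c P \<longleftrightarrow>
     (\<forall>v\<in>verts q. c v (parent v) = q) \<and>
     (\<exists>p :: int \<Rightarrow> vertex. \<forall>n. p n \<in> verts q \<and> p n = parent (p (n + 1)) \<and> c (p n) (p (n + 1)) = 0) \<and>
     (\<forall>u1\<in>verts q. \<forall>u2\<in>verts q. \<exists>x\<in>P. x u1 = u2 \<and>
        (\<forall>a\<in>subtree q u1. \<forall>b\<in>subtree q u1. {a, b} \<in> edges q \<longrightarrow> c (x a) (x b) = c a b))"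

section \<open>The rooted tree\<close>

abbreviation strings :: "nat \<Rightarrow> nat list set" where
  "strings q \<equiv> lists {..<q}"

definition rooted_edges :: "nat \<Rightarrow> nat list set set" where
  "rooted_edges q = {{w, w @ [j]} | w j. w \<in> strings q \<and> j < q}"

definition isom_rooted :: "nat \<Rightarrow> (nat list \<Rightarrow> nat list) set" where
  "isom_rooted q = {g \<in> isom (strings q) (rooted_edges q). g [] = []}"

text \<open>\<open>rooted_section q g w\<close> is \<open>g|\<^sub>w\<close>; see \<open>rooted_section_append\<close> below.\<close>

definition rooted_section :: "nat \<Rightarrow> (nat list \<Rightarrow> nat list) \<Rightarrow> nat list \<Rightarrow> nat list \<Rightarrow> nat list" where
  "rooted_section q g w = (\<lambda>u\<in>strings q. drop (length (g w)) (g (w @ u)))"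

definition self_similar :: "nat \<Rightarrow> (nat list \<Rightarrow> nat list) set \<Rightarrow> bool" where
  "self_similar q G \<longleftrightarrow> subgroup G (group_on (strings q) (isom_rooted q)) \<and>
     (\<forall>g\<in>G. \<forall>w\<in>strings q. rooted_section q g w \<in> G)"

definition self_replicating :: "nat \<Rightarrow> (nat list \<Rightarrow> nat list) set \<Rightarrow> bool" where
  "self_replicating q G \<longleftrightarrow> self_similar q G \<and>
     (\<forall>i<q. \<forall>j<q. \<exists>g\<in>G. g [i] = [j]) \<and>
     (\<forall>w\<in>strings q. (\<lambda>g. rooted_section q g w) ` {g \<in> G. g w = w} = G)"

section \<open>Sections of automorphisms of the regular tree\<close>

text \<open>\<open>phi v\<close> deletes the initial string \<open>v\<close> from a vertex of \<open>subtree q v\<close>.\<close>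

definition phi :: "vertex \<Rightarrow> vertex \<Rightarrow> nat list" where
  "phi v u = map (snd u) [fst v + 1..fst u]"

definition reg_section :: "nat \<Rightarrow> (vertex \<Rightarrow> vertex) \<Rightarrow> vertex \<Rightarrow> nat list \<Rightarrow> nat list" where
  "reg_section q g v = restrict (phi (g v) \<circ> g \<circ> inv_into (subtree q v) (phi v)) (strings q)"

section \<open>Basic facts confirming the encodings\<close>

lemma verts_iff:
  "(n, w) \<in> verts q \<longleftrightarrow> (\<forall>i\<le>n. w i < q) \<and> (\<forall>i>n. w i = undefined) \<and> finite {i. i \<le> n \<and> w i \<noteq> 0}"
  unfolding verts_def PiE_def Pi_def extensional_def by (simp add: not_le)

lemma parent_child: assumes "v \<in> verts q" shows "parent (child v j) = v"
proof (cases v)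
  case (Pair n w)
  with assms have "\<forall>i>n. w i = undefined" by (simp add: verts_iff)
  then have "restrict (w(n + 1 := j)) {..n} = w" by (intro ext) simp
  then show ?thesis using Pair by simp
qed

lemma child_last_parent: assumes "v \<in> verts q" shows "child (parent v) (snd v (fst v)) = v"
proof (cases v)
  case (Pair n w)
  with assms have "\<forall>i>n. w i = undefined" by (simp add: verts_iff)
  then have "(restrict w {..n - 1})(n := w n) = w" by (intro ext) simp
  then show ?thesis using Pair by simp
qed

lemma parent_in_verts: assumes "v \<in> verts q" shows "parent v \<in> verts q"
proof (cases v)
  case (Pair n w)
  have "{i. i \<le> n - 1 \<and> restrict w {..n - 1} i \<noteq> 0} \<subseteq> {i. i \<le> n \<and> w i \<noteq> 0}" by auto
  then have "finite {i. i \<le> n - 1 \<and> restrict w {..n - 1} i \<noteq> 0}"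
    by (rule finite_subset) (use assms Pair in \<open>simp add: verts_iff\<close>)
  then show ?thesis using assms Pair by (simp only: parent.simps verts_iff) simp
qed

lemma child_in_verts: assumes "v \<in> verts q" "j < q" shows "child v j \<in> verts q"
proof (cases v)
  case (Pair n w)
  have "{i. i \<le> n + 1 \<and> (w(n + 1 := j)) i \<noteq> 0} \<subseteq> insert (n + 1) {i. i \<le> n \<and> w i \<noteq> 0}" by auto
  then have "finite {i. i \<le> n + 1 \<and> (w(n + 1 := j)) i \<noteq> 0}"
    by (rule finite_subset) (use assms Pair in \<open>simp add: verts_iff\<close>)
  then show ?thesis using assms Pair by (simp only: child.simps verts_iff) simp
qed

lemma parent_ray_eq:
  assumes "(n, w) \<in> verts q" shows "parent_ray (n, w) k = (n - int k, restrict w {..n - int k})"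
proof (induction k)
  case 0
  have "restrict w {..n} = w" using assms by (intro ext) (simp add: verts_iff)
  then show ?case by (simp add: parent_ray_def)
next
  case (Suc k)
  have "restrict (restrict w {..n - int k}) {..n - int k - 1} = restrict w {..n - int (Suc k)}"
    by (intro ext) simp
  moreover have "parent_ray (n, w) (Suc k) = parent (parent_ray (n, w) k)"
    by (simp add: parent_ray_def)
  ultimately show ?case unfolding Suc parent.simps by (simp only:) (simp add: restrict_def)
qed

lemma parent_ray_in_rays: assumes "v \<in> verts q" shows "parent_ray v \<in> rays (verts q) (edges q)"
proof -
  obtain n w where v: "v = (n, w)" by (cases v)
  have in_verts: "parent_ray v k \<in> verts q" for k
    by (induction k) (auto simp: parent_ray_def assms parent_in_verts)
  moreover have "inj (parent_ray v)"
    using assms unfolding v by (auto simp: inj_def parent_ray_eq)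
  moreover have "{parent_ray v i, parent_ray v (Suc i)} \<in> edges q" for i
    using in_verts[of i] unfolding edges_def parent_ray_def funpow.simps comp_apply by blast
  ultimately show ?thesis by (auto simp: rays_def)
qed

lemma parent_ray_in_omega:
  assumes "v \<in> verts q" "q > 0" shows "parent_ray v \<in> omega q"
proof -
  obtain n w where v: "v = (n, w)" by (cases v)
  define z where "z = restrict (\<lambda>_::int. 0::nat) {..0}"
  have z: "(0, z) \<in> verts q" using assms(2) by (auto simp: verts_def z_def)
  have fin: "finite {i. i \<le> n \<and> w i \<noteq> 0}" using assms v by (auto simp: verts_def)
  obtain m where m: "m \<le> 0" "m \<le> n" "\<forall>i\<le>m. w i = 0"
  proof -
    define A where "A = insert 0 (insert n {i. i \<le> n \<and> w i \<noteq> 0})"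
    have A: "finite A" "A \<noteq> {}" using fin by (auto simp: A_def)
    have "\<forall>a\<in>A. Min A - 1 < a" using Min_le[OF A(1)] by force
    then have "Min A - 1 < 0" "Min A - 1 < n" "\<forall>i. i \<le> n \<and> w i \<noteq> 0 \<longrightarrow> Min A - 1 < i"
      unfolding A_def by blast+
    moreover from this have "w i = 0" if "i \<le> Min A - 1" for i
      using that by (smt (verit))
    ultimately show ?thesis using that[of "Min A - 1"] by simp
  qed
  have common: "parent_ray v (nat (n - i)) = parent_ray (0, z) (nat (- i))" if "i \<le> m" for i
    using that m assms(1) z unfolding v
    by (auto simp: parent_ray_eq z_def restrict_def fun_eq_iff)
  have "(\<lambda>i. parent_ray (0, z) (nat (- i))) ` {..m} \<subseteq> range (parent_ray (0, z)) \<inter> range (parent_ray v)"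
    using common by (metis (no_types, lifting) IntI atMost_iff image_subsetI rangeI)
  moreover have "inj_on (\<lambda>i. parent_ray (0, z) (nat (- i))) {..m}"
    using z m(1) by (auto simp: inj_on_def parent_ray_eq)
  moreover have "infinite {..m}" by (rule infinite_Iic)
  ultimately have "infinite (range (parent_ray (0, z)) \<inter> range (parent_ray v))"
    by (meson finite_imageD finite_subset)
  then show ?thesis
    using parent_ray_in_rays[OF z] parent_ray_in_rays[OF assms(1)]
    by (auto simp: omega_def end_rel_def z_def)
qed

lemma foldl_child:
  "foldl child (n, w) s = (n + int (length s),
     \<lambda>i. if n < i \<and> i \<le> n + int (length s) then s ! nat (i - n - 1) else w i)"
proof (induction s rule: rev_induct)
  case (snoc j s)
  then show ?case by (auto simp: fun_eq_iff nth_append)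
qed auto

lemma phi_foldl_child: "phi v (foldl child v s) = s"
  by (cases v) (auto simp: phi_def foldl_child intro!: nth_equalityI)

lemma subtree_eq:
  assumes v: "v \<in> verts q"
  shows "subtree q v = foldl child v ` strings q"
proof -
  let ?R = "{(a, b). {a, b} \<in> edges q - {{v, parent v}}}"
  have fold_verts: "foldl child v s \<in> verts q" if "s \<in> strings q" for s
    using that by (induction s rule: rev_induct) (auto simp: v child_in_verts)
  have lev: "fst (foldl child v s) = fst v + int (length s)" for s
    by (cases v) (simp add: foldl_child)
  have levp: "fst (parent u) = fst u - 1" for u by (cases u) simp
  have "u \<in> foldl child v ` strings q" if "(v, u) \<in> ?R\<^sup>*" for u
    using that
  proof (induction rule: rtrancl_induct)
    case base
    have "v = foldl child v []" by simp
    then show ?case by blast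
  next
    case (step a b)
    then obtain s where s: "s \<in> strings q" "a = foldl child v s" by auto
    from step obtain x where x: "x \<in> verts q" "{a, b} = {x, parent x}" "{a, b} \<noteq> {v, parent v}"
      unfolding edges_def by blast
    then consider "a = x" "b = parent x" | "b = x" "a = parent x"
      by (auto simp: doubleton_eq_iff)
    then show ?case
    proof cases
      case 1
      then have "s \<noteq> []" using x s by auto
      then obtain t j where t: "s = t @ [j]" by (cases s rule: rev_cases) auto
      then have "b = foldl child v t"
        using 1 s fold_verts[of t] parent_child[of "foldl child v t" q j] by auto
      then show ?thesis using s t by auto
    next
      case 2
      have "snd x (fst x) < q" using x by (cases x) (auto simp: verts_def PiE_def Pi_def)
      moreover have "b = foldl child v (s @ [snd x (fst x)])"
        using 2 x s child_last_parent[of x q] by simp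
      moreover have "s @ [snd x (fst x)] \<in> strings q" using s(1) \<open>snd x (fst x) < q\<close> by simp
      ultimately show ?thesis by blast
    qed
  qed
  moreover have "(v, foldl child v s) \<in> ?R\<^sup>*" if "s \<in> strings q" for s
    using that
  proof (induction s rule: rev_induct)
    case (snoc j s)
    let ?a = "foldl child v s" and ?b = "foldl child v (s @ [j])"
    have p: "parent ?b = ?a" "?b \<in> verts q"
      using snoc.prems fold_verts[of s] fold_verts[of "s @ [j]"] parent_child by auto
    then have "{?b, parent ?b} \<in> edges q" unfolding edges_def by blast
    then have "{?a, ?b} \<in> edges q" using p by (simp only: insert_commute)
    moreover have "{?a, ?b} \<noteq> {v, parent v}"
    proof
      assume "{?a, ?b} = {v, parent v}"
      then have "?b = v \<or> ?b = parent v" by blast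
      then have "fst ?b \<le> fst v" using levp[of v] by auto
      then show False using lev[of "s @ [j]"] by simp
    qed
    ultimately have "(?a, ?b) \<in> ?R" by simp
    moreover have "(v, ?a) \<in> ?R\<^sup>*" using snoc by auto
    ultimately show ?case by (rule rtrancl_into_rtrancl[rotated])
  qed simp
  ultimately show ?thesis unfolding subtree_def component_def by blast
qed

lemma inv_phi:
  assumes "v \<in> verts q" "s \<in> strings q"
  shows "inv_into (subtree q v) (phi v) s = foldl child v s"
proof -
  have "inj_on (phi v) (subtree q v)"
    using assms(1) by (auto simp: subtree_eq inj_on_def phi_foldl_child)
  then show ?thesis
    using assms by (metis inv_into_f_f imageI phi_foldl_child subtree_eq)
qed

lemma isom_rooted_snoc:
  assumes g: "g \<in> isom_rooted q" and w: "w \<in> strings q" and j: "j < q"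
  shows "\<exists>k<q. g (w @ [j]) = g w @ [k]"
  using w j
proof (induction w arbitrary: j rule: length_induct)
  case (1 w)
  have inj: "inj_on g (strings q)" and edge: "\<And>a b. a \<in> strings q \<Longrightarrow> b \<in> strings q \<Longrightarrow>
      {g a, g b} \<in> rooted_edges q \<longleftrightarrow> {a, b} \<in> rooted_edges q" and root: "g [] = []"
    using g by (auto simp: isom_rooted_def isom_def Bij_def bij_betw_def)
  have "{w, w @ [j]} \<in> rooted_edges q" using 1 by (auto simp: rooted_edges_def)
  then have "{g w, g (w @ [j])} \<in> rooted_edges q" using 1 edge by auto
  then obtain x k where x: "x \<in> strings q" "k < q" "{g w, g (w @ [j])} = {x, x @ [k]}"
    by (auto simp: rooted_edges_def)
  then consider "g w = x" "g (w @ [j]) = x @ [k]" | "g w = x @ [k]" "g (w @ [j]) = x"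
    by (auto simp: doubleton_eq_iff)
  then show ?case
  proof cases
    case 1
    then show ?thesis using x by auto
  next
    case 2
    then have "w \<noteq> []" using root by auto
    then obtain t i where t: "w = t @ [i]" by (cases w rule: rev_cases) auto
    then have "\<exists>k'<q. g (t @ [i]) = g t @ [k']" using "1.IH" "1.prems" by auto
    then obtain k' where "g w = g t @ [k']" using t by blast
    then have "g (w @ [j]) = g t" using 2 by auto
    moreover have "w @ [j] \<in> strings q" "t \<in> strings q" using "1.prems" t by auto
    ultimately have "w @ [j] = t" using inj by (metis inj_onD)
    then show ?thesis using t by simp
  qed
qed

lemma rooted_section_append:
  assumes g: "g \<in> isom_rooted q" and w: "w \<in> strings q" and u: "u \<in> strings q"
  shows "g (w @ u) = g w @ rooted_section q g w u"
proof -
  have "\<exists>y. g (w @ u) = g w @ y" using u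
  proof (induction u rule: rev_induct)
    case (snoc j u)
    then show ?case using isom_rooted_snoc[OF g, of "w @ u" j] w by auto
  qed simp
  then show ?thesis using u by (auto simp: rooted_section_def)
qed

lemma reg_section_append:
  assumes "v \<in> verts q" "s \<in> strings q"
  shows "reg_section q g v s = phi (g v) (g (foldl child v s))"
  using assms by (simp add: reg_section_def inv_phi)

end

(* The group P consists of the automorphisms of the regular tree that commute with the parent map
   and all of whose sections lie in Phat. Commuting with the parent map and membership of sections
   in the closed group Phat are conditions on finitely many vertices at a time, so P is closed; and
   x fixes omega because any two rays of parents eventually coincide.

   Transitivity, compatibility and P|_v = Phat all come from one extension property: for vertices a, b
   and h in Phat there is x in P with x a = b and x|_a = h. To extend x from T_a to T_(a^+), let i and j
   be the last symbols of a and b, choose k in Phat mapping i to j, correct it by an element of the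
   stabiliser of i so that the section at i becomes h, and repeat along the two rays to omega. *)

theory Submission
  imports Defs
begin

section \<open>Subgroups of the group of bijections of a set\<close>

section \<open>Groups of bijections and the pointwise topology\<close>

text \<open>Translates the group operations of \<open>BijGroup\<close> into \<open>compose\<close>
  and \<open>inv_into\<close>, so that the later subgroup proofs deal with functions only.\<close>

lemma subgroup_BijGroupI:
  assumes "H \<subseteq> Bij V" "restrict (\<lambda>x. x) V \<in> H"
    and "\<And>f g. f \<in> H \<Longrightarrow> g \<in> H \<Longrightarrow> compose V f g \<in> H"
    and "\<And>f. f \<in> H \<Longrightarrow> restrict (inv_into V f) V \<in> H"
  shows "subgroup H (BijGroup V)"
proof (rule subgroup.intro)
  show "H \<subseteq> carrier (BijGroup V)" "\<one>\<^bsub>BijGroup V\<^esub> \<in> H"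
    using assms by (auto simp: BijGroup_def)
  show "f \<otimes>\<^bsub>BijGroup V\<^esub> g \<in> H" if "f \<in> H" "g \<in> H" for f g
    using that assms(1) assms(3)[OF that] by (auto simp: BijGroup_def)
  show "inv\<^bsub>BijGroup V\<^esub> f \<in> H" if "f \<in> H" for f
    using that assms(1) assms(4)[OF that] inv_BijGroup[of f V] by auto
qed

lemma subgroup_BijGroupD:
  assumes "subgroup H (BijGroup V)"
  shows "H \<subseteq> Bij V" "restrict (\<lambda>x. x) V \<in> H"
    and "\<And>f g. f \<in> H \<Longrightarrow> g \<in> H \<Longrightarrow> compose V f g \<in> H"
    and "\<And>f. f \<in> H \<Longrightarrow> restrict (inv_into V f) V \<in> H"
proof -
  have Bij: "f \<in> Bij V" if "f \<in> H" for f
    using subsetD[OF subgroup.subset[OF assms] that] by (simp add: BijGroup_def)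
  then show "H \<subseteq> Bij V" by blast
  show "restrict (\<lambda>x. x) V \<in> H"
    using subgroup.one_closed[OF assms] by (simp add: BijGroup_def)
  show "compose V f g \<in> H" if "f \<in> H" "g \<in> H" for f g
    using subgroup.m_closed[OF assms that] Bij[OF that(1)] Bij[OF that(2)] by (simp add: BijGroup_def)
  show "restrict (inv_into V f) V \<in> H" if "f \<in> H" for f
    using subgroup.m_inv_closed[OF assms that] inv_BijGroup[OF Bij[OF that]] by simp
qed

lemma compose_restrict_inv_into:
  assumes "f \<in> Bij V"
  shows "compose V f (restrict (inv_into V f) V) = restrict (\<lambda>x. x) V"
  using assms by (auto simp: compose_def fun_eq_iff Bij_def bij_betw_def f_inv_into_f)

text \<open>In a group a left inverse is the inverse. This later identifies a section of an inverse
  with the inverse of a section.\<close>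

lemma restrict_inv_into_unique:
  assumes "f \<in> Bij V" "g \<in> Bij V" "compose V g f = restrict (\<lambda>x. x) V"
  shows "g = restrict (inv_into V f) V"
proof -
  have "inv\<^bsub>BijGroup V\<^esub> f = g"
    using assms by (intro group.inv_equality[OF group_BijGroup]) (auto simp: BijGroup_def)
  then show ?thesis using inv_BijGroup[OF assms(1)] by simp
qed

lemma subgroup_isom: "subgroup (isom V E) (BijGroup V)"
proof (rule subgroup_BijGroupI)
  show "isom V E \<subseteq> Bij V" by (auto simp: isom_def)
  show "restrict (\<lambda>x. x) V \<in> isom V E" by (auto simp: isom_def id_Bij)
  show "compose V f g \<in> isom V E" if "f \<in> isom V E" "g \<in> isom V E" for f g
  proof -
    have "g a \<in> V" if "a \<in> V" for a
      using that \<open>g \<in> isom V E\<close> Bij_imp_funcset by (auto simp: isom_def)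
    then show ?thesis
      using that by (auto simp: isom_def compose_Bij compose_eq)
  qed
  show "restrict (inv_into V f) V \<in> isom V E" if "f \<in> isom V E" for f
  proof -
    have f: "f \<in> Bij V" "\<And>a b. a \<in> V \<Longrightarrow> b \<in> V \<Longrightarrow> {f a, f b} \<in> E \<longleftrightarrow> {a, b} \<in> E"
      using that by (auto simp: isom_def)
    have "inv_into V f a \<in> V \<and> f (inv_into V f a) = a" if "a \<in> V" for a
      using that f(1) by (auto simp: Bij_def bij_betw_def inv_into_into f_inv_into_f)
    then show ?thesis
      using f by (auto simp: isom_def restrict_inv_into_Bij) metis+
  qed
qed

lemma subgroup_isom_rooted: "subgroup (isom_rooted q) (BijGroup (strings q))"
proof (rule subgroup_BijGroupI)
  note D = subgroup_BijGroupD[OF subgroup_isom[of "strings q" "rooted_edges q"]]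
  show "isom_rooted q \<subseteq> Bij (strings q)" using D(1) by (auto simp: isom_rooted_def)
  show "restrict (\<lambda>x. x) (strings q) \<in> isom_rooted q" using D(2) by (auto simp: isom_rooted_def)
  show "compose (strings q) f g \<in> isom_rooted q" if "f \<in> isom_rooted q" "g \<in> isom_rooted q" for f g
    using that D(3) by (auto simp: isom_rooted_def compose_eq)
  show "restrict (inv_into (strings q) f) (strings q) \<in> isom_rooted q" if "f \<in> isom_rooted q" for f
  proof -
    have "inj_on f (strings q)" "f [] = []"
      using that by (auto simp: isom_rooted_def isom_def Bij_def bij_betw_def)
    then have "inv_into (strings q) f [] = []" by (metis inv_into_f_f lists.Nil)
    then show ?thesis using that D(4) by (auto simp: isom_rooted_def)
  qed
qed

section \<open>Closed sets for pointwise convergence, via agreement on finite sets\<close>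

lemma topspace_pointwise_topology:
  "topspace (pointwise_topology V A) = (V \<rightarrow>\<^sub>E V) \<inter> A"
  unfolding pointwise_topology_def topspace_subtopology topspace_product_topology
    topspace_discrete_topology o_def ..

text \<open>If \<open>g\<close> were outside \<open>S\<close>, a basic open neighbourhood of
  \<open>g\<close> would avoid \<open>S\<close>. Such a neighbourhood restricts only finitely many
  coordinates, so an element of \<open>S\<close> that agrees with \<open>g\<close> there lies in
  it.\<close>

lemma closedin_pointwise_topologyD:
  assumes cl: "closedin (pointwise_topology V A) S" and g: "g \<in> A" "g \<in> V \<rightarrow>\<^sub>E V"
    and agree: "\<And>F. finite F \<Longrightarrow> F \<subseteq> V \<Longrightarrow> \<exists>h\<in>S. \<forall>a\<in>F. h a = g a"
  shows "g \<in> S"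
proof (rule ccontr)
  assume "g \<notin> S"
  have S: "S \<subseteq> (V \<rightarrow>\<^sub>E V) \<inter> A"
    using closedin_subset[OF cl] unfolding topspace_pointwise_topology .
  have "openin (pointwise_topology V A) ((V \<rightarrow>\<^sub>E V) \<inter> A - S)"
    using cl unfolding closedin_def topspace_pointwise_topology by blast
  then obtain W where W: "openin (product_topology (\<lambda>_. discrete_topology V) V) W"
    "(V \<rightarrow>\<^sub>E V) \<inter> A - S = W \<inter> A"
    by (auto simp: pointwise_topology_def openin_subtopology)
  then have "g \<in> W" using g \<open>g \<notin> S\<close> by auto
  then obtain U where U: "finite {i \<in> V. U i \<noteq> V}" "g \<in> Pi\<^sub>E V U" "Pi\<^sub>E V U \<subseteq> W"
    using W(1) unfolding openin_product_topology_alt by (metis topspace_discrete_topology)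
  obtain h where h: "h \<in> S" "\<forall>a\<in>{i \<in> V. U i \<noteq> V}. h a = g a"
    using agree[OF U(1)] by auto
  have "h i \<in> U i" if "i \<in> V" for i
    using h S U(2) that by (cases "U i = V") auto
  then have "h \<in> Pi\<^sub>E V U" using h S by auto
  then show False using h S U W by blast
qed

text \<open>For \<open>g\<close> outside \<open>S\<close>, some finite \<open>F\<close> separates
  \<open>g\<close> from every element of \<open>S\<close>; the maps that agree with \<open>g\<close>
  on \<open>F\<close> then form an open neighbourhood disjoint from \<open>S\<close>.\<close>

lemma closedin_pointwise_topologyI:
  assumes S: "S \<subseteq> A" and A: "A \<subseteq> V \<rightarrow>\<^sub>E V"
    and closed: "\<And>g. g \<in> A \<Longrightarrow> (\<And>F. finite F \<Longrightarrow> F \<subseteq> V \<Longrightarrow> \<exists>h\<in>S. \<forall>a\<in>F. h a = g a) \<Longrightarrow> g \<in> S"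
  shows "closedin (pointwise_topology V A) S"
proof -
  have "\<exists>W. openin (pointwise_topology V A) W \<and> g \<in> W \<and> W \<subseteq> A - S" if g: "g \<in> A - S" for g
  proof -
    obtain F where F: "finite F" "F \<subseteq> V" "\<forall>h\<in>S. \<exists>a\<in>F. h a \<noteq> g a"
      using closed[of g] g by (metis DiffE)
    define U where "U i = (if i \<in> F then {g i} else V)" for i
    have gV: "g \<in> V \<rightarrow>\<^sub>E V" using g A by auto
    have "finite {i \<in> V. U i \<noteq> V}"
      by (rule finite_subset[OF _ F(1)]) (auto simp: U_def)
    then have "openin (product_topology (\<lambda>_. discrete_topology V) V) (Pi\<^sub>E V U)"
      using gV unfolding openin_PiE_gen topspace_discrete_topology by (auto simp: U_def)
    then have "openin (pointwise_topology V A) (Pi\<^sub>E V U \<inter> A)"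
      unfolding pointwise_topology_def by (rule openin_subtopology_Int)
    moreover have "g \<in> Pi\<^sub>E V U \<inter> A" using g gV by (auto simp: U_def)
    moreover have "Pi\<^sub>E V U \<inter> A \<subseteq> A - S"
    proof
      fix h assume h: "h \<in> Pi\<^sub>E V U \<inter> A"
      have "h a = g a" if "a \<in> F" for a
        using PiE_mem[of h V U a] h F(2) that by (auto simp: U_def)
      then show "h \<in> A - S" using h F(3) by auto
    qed
    ultimately show ?thesis by blast
  qed
  then have "openin (pointwise_topology V A) (A - S)"
    by (rule openin_subopen[THEN iffD2, rule_format])
  then show ?thesis
    using S A unfolding closedin_def topspace_pointwise_topology by (simp add: Int_absorb1)
qed

section \<open>Vertices and ancestors\<close>

lemma fst_parent: "fst (parent v) = fst v - 1"
  by (cases v) simp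

lemma fst_child: "fst (child v j) = fst v + 1"
  by (cases v) simp

lemma last_symbol_less: "v \<in> verts q \<Longrightarrow> snd v (fst v) < q"
  by (cases v) (simp add: verts_iff)

lemma foldl_child_in_verts:
  "v \<in> verts q \<Longrightarrow> s \<in> strings q \<Longrightarrow> foldl child v s \<in> verts q"
  by (induction s rule: rev_induct) (auto simp: child_in_verts)

lemma foldl_child_inject: "foldl child v s = foldl child v t \<longleftrightarrow> s = t"
  by (metis phi_foldl_child)

section \<open>Ancestors, and how the rays towards omega merge\<close>

lemma parent_ray_in_verts: "v \<in> verts q \<Longrightarrow> parent_ray v k \<in> verts q"
  by (induction k) (auto simp: parent_ray_def parent_in_verts)

lemma parent_ray_0: "parent_ray v 0 = v"
  by (simp add: parent_ray_def)

lemma parent_ray_Suc: "parent_ray v (Suc k) = parent (parent_ray v k)"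
  by (simp add: parent_ray_def)

lemma parent_ray_add: "parent_ray v (k + m) = parent_ray (parent_ray v m) k"
  by (simp add: parent_ray_def funpow_add)

lemma parent_ray_child:
  "v \<in> verts q \<Longrightarrow>
    parent_ray v k = child (parent_ray v (Suc k)) (snd (parent_ray v k) (fst (parent_ray v k)))"
  using child_last_parent[OF parent_ray_in_verts] by (simp add: parent_ray_Suc)

text \<open>Each step upwards puts the last symbol of the ancestor just left in front of the
  string.\<close>

lemma descendant_parent_ray:
  assumes "v \<in> verts q"
  shows "\<exists>s\<in>strings q. v = foldl child (parent_ray v k) s"
proof (induction k)
  case 0
  show ?case by (rule bexI[of _ "[]"]) (auto simp: parent_ray_0)
next
  case (Suc k)
  then obtain s where s: "s \<in> strings q" "v = foldl child (parent_ray v k) s" by blast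
  let ?j = "snd (parent_ray v k) (fst (parent_ray v k))"
  have "?j # s \<in> strings q"
    using s(1) last_symbol_less[OF parent_ray_in_verts[OF assms]] by simp
  moreover have "v = foldl child (parent_ray v (Suc k)) (?j # s)"
    using s(2) parent_ray_child[OF assms] by simp
  ultimately show ?case by blast
qed

text \<open>Membership in \<open>omega q\<close> makes each of the two rays meet the base ray from
  the zero string \<open>?z\<close>.\<close>

lemma parent_rays_meet:
  assumes "q > 0" "u \<in> verts q" "v \<in> verts q"
  shows "\<exists>k m. parent_ray u k = parent_ray v m"
proof -
  let ?z = "(0, restrict (\<lambda>_. 0) {..0}) :: vertex"
  have meet: "\<exists>i j. parent_ray ?z i = parent_ray w j" if "w \<in> verts q" for w
  proof -
    have "infinite (range (parent_ray ?z) \<inter> range (parent_ray w))"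
      using parent_ray_in_omega[OF that assms(1)] by (simp add: omega_def end_rel_def)
    then have "range (parent_ray ?z) \<inter> range (parent_ray w) \<noteq> {}" by (rule infinite_imp_nonempty)
    then show ?thesis by blast
  qed
  obtain i j k m where
    "parent_ray ?z i = parent_ray u j" "parent_ray ?z k = parent_ray v m"
    using meet[OF assms(2)] meet[OF assms(3)] by blast
  \<comment> \<open>From the two meeting points, at positions \<open>i\<close> and \<open>k\<close>
    of the base ray, walk up \<open>k\<close> and \<open>i\<close> further steps: both walks end at
    position \<open>i + k\<close>.\<close>
  then have "parent_ray u (k + j) = parent_ray v (i + m)"
    using parent_ray_add[of ?z k i] parent_ray_add[of ?z i k]
    by (simp add: parent_ray_add add.commute[of i k])
  then show ?thesis by blast
qed

text \<open>After a common vertex both rays follow the same parents, so only the part of the first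
  ray before that vertex can lie off the second.\<close>

lemma finite_parent_ray_diff:
  assumes "q > 0" "u \<in> verts q" "v \<in> verts q"
  shows "finite (range (parent_ray u) - range (parent_ray v))"
proof -
  obtain k m where km: "parent_ray u k = parent_ray v m"
    using parent_rays_meet[OF assms] by blast
  have "parent_ray u i \<in> range (parent_ray v)" if "i \<ge> k" for i
  proof
    show "parent_ray u i = parent_ray v (i - k + m)"
      by (simp only: parent_ray_add km[symmetric]) (simp add: parent_ray_add[symmetric] that)
  qed simp
  then have "range (parent_ray u) - range (parent_ray v) \<subseteq> parent_ray u ` {..<k}"
    by (force simp: not_le[symmetric])
  then show ?thesis by (rule finite_subset) simp
qed

section \<open>Adjacency in both trees, expressed by parents\<close>

lemma edge_iff:
  assumes "a \<in> verts q" "b \<in> verts q"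
  shows "{a, b} \<in> edges q \<longleftrightarrow> a = parent b \<or> b = parent a"
proof
  assume "{a, b} \<in> edges q"
  then show "a = parent b \<or> b = parent a"
    by (auto simp: edges_def doubleton_eq_iff)
next
  have "{c, parent c} \<in> edges q" if "c \<in> verts q" for c
    using that unfolding edges_def by blast
  from this[OF assms(1)] this[OF assms(2)]
  show "{a, b} \<in> edges q" if "a = parent b \<or> b = parent a"
    using that by (auto simp: insert_commute)
qed

text \<open>Here \<open>butlast\<close> takes the place of \<open>parent\<close>, so that preserving
  edges reduces to commuting with \<open>butlast\<close>.\<close>

lemma rooted_edge_iff:
  assumes "a \<in> strings q" "b \<in> strings q"
  shows "{a, b} \<in> rooted_edges q \<longleftrightarrow> a \<noteq> [] \<and> b = butlast a \<or> b \<noteq> [] \<and> a = butlast b"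
proof
  assume "{a, b} \<in> rooted_edges q"
  then show "a \<noteq> [] \<and> b = butlast a \<or> b \<noteq> [] \<and> a = butlast b"
    by (auto simp: rooted_edges_def doubleton_eq_iff)
next
  have "{butlast c, c} \<in> rooted_edges q" if "c \<in> strings q" "c \<noteq> []" for c
    using that unfolding rooted_edges_def by (cases c rule: rev_cases) auto
  then show "{a, b} \<in> rooted_edges q" if "a \<noteq> [] \<and> b = butlast a \<or> b \<noteq> [] \<and> a = butlast b"
    using that assms by (metis insert_commute)
qed

section \<open>Automorphisms commuting with the parent map\<close>

text \<open>One equation in place of two conditions: that such bijections are automorphisms, and for
  positive \<open>q\<close> fix the end \<open>omega q\<close>, is derived below.\<close>

definition parent_isom :: "nat \<Rightarrow> (vertex \<Rightarrow> vertex) set" where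
  "parent_isom q = {x \<in> Bij (verts q). \<forall>v\<in>verts q. x (parent v) = parent (x v)}"

lemma parent_isom_in_verts: "x \<in> parent_isom q \<Longrightarrow> v \<in> verts q \<Longrightarrow> x v \<in> verts q"
  using Bij_imp_funcset by (auto simp: parent_isom_def)

lemma subgroup_parent_isom: "subgroup (parent_isom q) (BijGroup (verts q))"
proof (rule subgroup_BijGroupI)
  show "parent_isom q \<subseteq> Bij (verts q)" by (auto simp: parent_isom_def)
  show "restrict (\<lambda>x. x) (verts q) \<in> parent_isom q"
    by (auto simp: parent_isom_def id_Bij parent_in_verts)
  show "compose (verts q) f g \<in> parent_isom q" if "f \<in> parent_isom q" "g \<in> parent_isom q" for f g
    using that parent_isom_in_verts[OF that(2)]
    by (auto simp: parent_isom_def compose_Bij compose_eq parent_in_verts)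
  show "restrict (inv_into (verts q) f) (verts q) \<in> parent_isom q" if f: "f \<in> parent_isom q" for f
  proof -
    have inj: "inj_on f (verts q)" and img: "f ` verts q = verts q"
      using f by (auto simp: parent_isom_def Bij_def bij_betw_def)
    have "inv_into (verts q) f (parent v) = parent (inv_into (verts q) f v)" if "v \<in> verts q" for v
    proof (rule inv_into_f_eq[OF inj])
      have u: "inv_into (verts q) f v \<in> verts q" "f (inv_into (verts q) f v) = v"
        using that img by (auto simp: inv_into_into f_inv_into_f)
      then show "parent (inv_into (verts q) f v) \<in> verts q" by (simp add: parent_in_verts)
      show "f (parent (inv_into (verts q) f v)) = parent v"
        using f u by (simp add: parent_isom_def)
    qed
    then show ?thesis
      using f by (auto simp: parent_isom_def restrict_inv_into_Bij parent_in_verts)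
  qed
qed

lemma parent_isom_subset_isom: "parent_isom q \<subseteq> isom_reg q"
proof
  fix x assume x: "x \<in> parent_isom q"
  have inj: "inj_on x (verts q)" using x by (auto simp: parent_isom_def Bij_def bij_betw_def)
  have "x a = parent (x b) \<longleftrightarrow> a = parent b" if "a \<in> verts q" "b \<in> verts q" for a b
    using x that inj parent_in_verts[OF that(2)] by (auto simp: parent_isom_def inj_on_def)
  then show "x \<in> isom_reg q"
    using x parent_isom_in_verts[OF x] by (auto simp: isom_def edge_iff parent_isom_def)
qed

lemma parent_isom_parent_ray:
  assumes "x \<in> parent_isom q" "v \<in> verts q"
  shows "x \<circ> parent_ray v = parent_ray (x v)"
proof
  show "(x \<circ> parent_ray v) k = parent_ray (x v) k" for k
    using assms parent_ray_in_verts[OF assms(2)]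
    by (induction k) (auto simp: parent_ray_0 parent_ray_Suc parent_isom_def)
qed

text \<open>The map \<open>x\<close> carries the infinitely many vertices shared by \<open>r\<close>
  and the base ray into the parent ray of \<open>x ?z\<close>. That ray leaves the base ray in only
  finitely many vertices, so \<open>x\<close> composed with \<open>r\<close> still shares infinitely
  many with the base ray.\<close>

lemma parent_isom_comp_omega:
  assumes q: "q > 0" and x: "x \<in> parent_isom q" and r: "r \<in> omega q"
  shows "x \<circ> r \<in> omega q"
proof -
  let ?z = "(0, restrict (\<lambda>_. 0) {..0}) :: vertex"
  have z: "?z \<in> verts q" using q by (auto simp: verts_def)
  have rr: "r \<in> rays (verts q) (edges q)" and inf: "infinite (range (parent_ray ?z) \<inter> range r)"
    using r by (auto simp: omega_def end_rel_def)
  have inj: "inj_on x (verts q)" using x by (auto simp: parent_isom_def Bij_def bij_betw_def)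
  have rv: "r i \<in> verts q" for i using rr by (auto simp: rays_def)
  have "inj (x \<circ> r)"
    using rr inj rv unfolding rays_def by (blast intro: comp_inj_on inj_on_subset)
  moreover have "x (r i) \<in> verts q" for i
    using parent_isom_in_verts[OF x rv] .
  moreover have "{x (r i), x (r (Suc i))} \<in> edges q" for i
  proof -
    have "{r i, r (Suc i)} \<in> edges q" using rr by (simp add: rays_def)
    then show ?thesis
      using subsetD[OF parent_isom_subset_isom x] rv unfolding isom_def by blast
  qed
  ultimately have "x \<circ> r \<in> rays (verts q) (edges q)"
    unfolding rays_def by (simp add: image_subset_iff)
  moreover have "infinite (range (parent_ray ?z) \<inter> range (x \<circ> r))"
  proof
    assume fin: "finite (range (parent_ray ?z) \<inter> range (x \<circ> r))"
    have "x ` (range (parent_ray ?z) \<inter> range r) \<subseteq> range (x \<circ> parent_ray ?z) \<inter> range (x \<circ> r)"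
      unfolding image_comp[symmetric] by blast
    also have "\<dots> = range (parent_ray (x ?z)) \<inter> range (x \<circ> r)"
      by (simp only: parent_isom_parent_ray[OF x z])
    also have "\<dots> \<subseteq> (range (parent_ray (x ?z)) - range (parent_ray ?z)) \<union>
        (range (parent_ray ?z) \<inter> range (x \<circ> r))" by blast
    finally have "finite (x ` (range (parent_ray ?z) \<inter> range r))"
      using fin finite_parent_ray_diff[OF q parent_isom_in_verts[OF x z] z]
      by (elim finite_subset) simp
    moreover have "inj_on x (range (parent_ray ?z) \<inter> range r)"
      using rv by (intro inj_on_subset[OF inj] subset_trans[OF Int_lower2]) (simp add: image_subset_iff)
    ultimately have "finite (range (parent_ray ?z) \<inter> range r)" by (rule finite_imageD)
    then show False using inf by contradiction
  qed
  ultimately show ?thesis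
    using parent_ray_in_rays[OF z] by (simp add: omega_def end_rel_def)
qed

text \<open>The end must be mapped onto itself, so the inclusion above is applied to
  \<open>x\<close> and to its inverse.\<close>

lemma parent_isom_fixes_omega:
  assumes q: "q > 0" and x: "x \<in> parent_isom q"
  shows "fixes_end x (omega q)"
proof -
  let ?y = "restrict (inv_into (verts q) x) (verts q)"
  have y: "?y \<in> parent_isom q" using subgroup_BijGroupD(4)[OF subgroup_parent_isom x] .
  have "r \<in> (\<circ>) x ` omega q" if r: "r \<in> omega q" for r
  proof
    show "?y \<circ> r \<in> omega q" using parent_isom_comp_omega[OF q y r] .
    have img: "x ` verts q = verts q" using x by (simp add: parent_isom_def Bij_def bij_betw_def)
    have "r i \<in> verts q" for i using r by (auto simp: omega_def end_rel_def rays_def)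
    then have "x (?y (r i)) = r i" for i using img by (simp add: f_inv_into_f)
    then show "r = x \<circ> (?y \<circ> r)" by (intro ext) (simp only: o_apply)
  qed
  then show ?thesis
    using parent_isom_comp_omega[OF q x] by (auto simp: fixes_end_def)
qed

section \<open>Sections\<close>

text \<open>By induction along the string: the image of a child has the image of its parent as
  parent, so it is obtained by appending one symbol.\<close>

lemma parent_isom_foldl_child_aux:
  assumes x: "x \<in> parent_isom q" and v: "v \<in> verts q" and s: "s \<in> strings q"
  shows "\<exists>t\<in>strings q. x (foldl child v s) = foldl child (x v) t"
  using s
proof (induction s rule: rev_induct)
  case Nil
  show ?case by (rule bexI[of _ "[]"]) auto
next
  case (snoc j s)
  then obtain t where t: "t \<in> strings q" "x (foldl child v s) = foldl child (x v) t" by auto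
  let ?b = "foldl child v (s @ [j])"
  have b: "?b \<in> verts q" "parent ?b = foldl child v s"
    using snoc.prems foldl_child_in_verts[OF v, of s] parent_child
    by (auto simp: child_in_verts)
  then have "parent (x ?b) = foldl child (x v) t" using x t(2) by (auto simp: parent_isom_def)
  moreover have xb: "x ?b \<in> verts q" using parent_isom_in_verts[OF x b(1)] .
  ultimately have "x ?b = foldl child (x v) (t @ [snd (x ?b) (fst (x ?b))])"
    using child_last_parent[OF xb] by simp
  moreover have "t @ [snd (x ?b) (fst (x ?b))] \<in> strings q"
    using t(1) last_symbol_less[OF xb] by simp
  ultimately show ?case by blast
qed

lemma reg_section_eqI:
  assumes "v \<in> verts q" "s \<in> strings q" "x (foldl child v s) = foldl child (x v) t"
  shows "reg_section q x v s = t"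
  using assms by (simp add: reg_section_append phi_foldl_child)

text \<open>Replaces the definition through \<open>inv_into\<close> by the working equation for
  sections; together with \<open>reg_section_eqI\<close> it is how sections are computed from here
  on.\<close>

lemma parent_isom_foldl_child:
  assumes "x \<in> parent_isom q" "v \<in> verts q" "s \<in> strings q"
  shows "reg_section q x v s \<in> strings q"
    and "x (foldl child v s) = foldl child (x v) (reg_section q x v s)"
proof -
  obtain t where t: "t \<in> strings q" "x (foldl child v s) = foldl child (x v) t"
    using parent_isom_foldl_child_aux[OF assms] by blast
  then have "reg_section q x v s = t" using reg_section_eqI[OF assms(2,3)] by blast
  then show "reg_section q x v s \<in> strings q"
    and "x (foldl child v s) = foldl child (x v) (reg_section q x v s)"
    using t by simp_all
qed

lemma reg_section_extensional: "reg_section q x v \<in> extensional (strings q)"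
  by (simp add: reg_section_def)

lemma reg_section_id:
  assumes "v \<in> verts q"
  shows "reg_section q (restrict (\<lambda>x. x) (verts q)) v = restrict (\<lambda>x. x) (strings q)"
proof (rule extensionalityI[OF reg_section_extensional])
  show "reg_section q (restrict (\<lambda>x. x) (verts q)) v s = restrict (\<lambda>x. x) (strings q) s"
    if "s \<in> strings q" for s
    using reg_section_eqI[OF assms that, of "restrict (\<lambda>x. x) (verts q)" s] that assms
    by (auto simp: foldl_child_in_verts)
qed auto

text \<open>The cocycle identity for sections: follow a descendant of \<open>v\<close> first through
  \<open>y\<close>, then through \<open>x\<close> from the vertex \<open>y v\<close>.\<close>

lemma reg_section_compose:
  assumes x: "x \<in> parent_isom q" and y: "y \<in> parent_isom q" and v: "v \<in> verts q"
  shows "reg_section q (compose (verts q) x y) v =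
    compose (strings q) (reg_section q x (y v)) (reg_section q y v)"
proof (rule extensionalityI[OF reg_section_extensional])
  show "reg_section q (compose (verts q) x y) v s =
      compose (strings q) (reg_section q x (y v)) (reg_section q y v) s"
    if s: "s \<in> strings q" for s
  proof (rule reg_section_eqI[OF v s])
    show "compose (verts q) x y (foldl child v s) = foldl child (compose (verts q) x y v)
        (compose (strings q) (reg_section q x (y v)) (reg_section q y v) s)"
      using s v foldl_child_in_verts[OF v s] parent_isom_foldl_child[OF y v s]
        parent_isom_foldl_child(2)[OF x parent_isom_in_verts[OF y v]]
      by (simp add: compose_eq)
  qed
qed (auto simp: compose_def)

text \<open>The cocycle identity applied to the two composites of \<open>x\<close> with its inverse,
  whose sections are trivial.\<close>

lemma reg_section_inverse:
  assumes x: "x \<in> parent_isom q" and v: "v \<in> verts q"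
  defines "y \<equiv> restrict (inv_into (verts q) x) (verts q)"
  shows "compose (strings q) (reg_section q x (y v)) (reg_section q y v) = restrict (\<lambda>s. s) (strings q)"
    and "compose (strings q) (reg_section q y (x v)) (reg_section q x v) = restrict (\<lambda>s. s) (strings q)"
proof -
  have y: "y \<in> parent_isom q" unfolding y_def by (rule subgroup_BijGroupD(4)[OF subgroup_parent_isom x])
  have x': "x \<in> Bij (verts q)" using x by (auto simp: parent_isom_def)
  show "compose (strings q) (reg_section q x (y v)) (reg_section q y v) = restrict (\<lambda>s. s) (strings q)"
    using reg_section_compose[OF x y v] compose_restrict_inv_into[OF x'] reg_section_id[OF v]
    by (simp add: y_def)
  show "compose (strings q) (reg_section q y (x v)) (reg_section q x v) = restrict (\<lambda>s. s) (strings q)"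
    using reg_section_compose[OF y x v] Bij_compose_restrict_eq[OF x'] reg_section_id[OF v]
    by (simp add: y_def)
qed

text \<open>The section \<open>?h\<close> of the inverse at \<open>x v\<close> inverts
  \<open>?g\<close>, which gives bijectivity; commuting with \<open>parent\<close> becomes commuting
  with \<open>butlast\<close>, which gives edges.\<close>

lemma reg_section_in_isom_rooted:
  assumes x: "x \<in> parent_isom q" and v: "v \<in> verts q"
  shows "reg_section q x v \<in> isom_rooted q"
proof -
  define y where "y = restrict (inv_into (verts q) x) (verts q)"
  have y: "y \<in> parent_isom q" unfolding y_def by (rule subgroup_BijGroupD(4)[OF subgroup_parent_isom x])
  have yx: "y (x v) = v"
    using x v parent_isom_in_verts[OF x v]
    by (auto simp: y_def parent_isom_def Bij_def bij_betw_def inv_into_f_f)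
  have xv: "x v \<in> verts q" using parent_isom_in_verts[OF x v] .
  let ?g = "reg_section q x v" and ?h = "reg_section q y (x v)"
  have gh: "?g (?h s) = s" "?h (?g s) = s" if "s \<in> strings q" for s
    using fun_cong[OF reg_section_inverse(1)[OF x xv, folded y_def], of s] that
      fun_cong[OF reg_section_inverse(2)[OF x v, folded y_def], of s] yx
    by (auto simp: compose_eq)
  have cl: "?g s \<in> strings q" "?h s \<in> strings q" if "s \<in> strings q" for s
    using parent_isom_foldl_child(1)[OF x v that] parent_isom_foldl_child(1)[OF y xv that] by auto
  have "bij_betw ?g (strings q) (strings q)"
    by (rule bij_betw_byWitness[where f' = ?h]) (use gh cl in \<open>simp_all add: image_subset_iff del: in_lists_conv_set\<close>)
  then have bij: "?g \<in> Bij (strings q)" by (simp add: Bij_def reg_section_extensional)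
  have root: "?g [] = []" by (rule reg_section_eqI[OF v]) auto
  have bl: "?g s \<noteq> [] \<and> ?g (butlast s) = butlast (?g s)" if s: "s \<in> strings q" "s \<noteq> []" for s
  proof -
    obtain t j where t: "s = t @ [j]" "t \<in> strings q" "j < q"
      using s by (cases s rule: rev_cases) auto
    have ne: "?g s \<noteq> []" using gh(2)[OF s(1)] gh(2)[of "[]"] root s(2) by auto
    then obtain t' j' where t': "?g s = t' @ [j']" "t' \<in> strings q"
      using cl(1)[OF s(1)] by (cases "?g s" rule: rev_cases) auto
    have "x (foldl child v t) = parent (x (foldl child v s))"
      using x foldl_child_in_verts[OF v s(1)] parent_child[OF foldl_child_in_verts[OF v t(2)]] t(1)
      by (auto simp: parent_isom_def)
    also have "\<dots> = foldl child (x v) t'"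
      using parent_isom_foldl_child(2)[OF x v s(1)] t' parent_child[OF foldl_child_in_verts[OF xv t'(2)]]
      by simp
    finally show ?thesis using reg_section_eqI[OF v t(2)] t(1) t'(1) ne by simp
  qed
  \<comment> \<open>The backward direction cancels \<open>?g\<close> by means of \<open>?h\<close>;
    that \<open>?g\<close> fixes the root keeps nonempty strings nonempty.\<close>
  have "a \<noteq> [] \<and> b = butlast a \<longleftrightarrow> ?g a \<noteq> [] \<and> ?g b = butlast (?g a)"
    if "a \<in> strings q" "b \<in> strings q" for a b
  proof -
    have "butlast a \<in> strings q" using that by (auto simp: in_lists_conv_set dest: in_set_butlastD)
    then show ?thesis using bl[OF that(1)] gh(2) that root by metis
  qed
  then show ?thesis
    using bij root cl by (simp add: isom_rooted_def isom_def rooted_edge_iff)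
qed

section \<open>Self-replicating groups\<close>

lemma isom_rooted_Bij: "g \<in> isom_rooted q \<Longrightarrow> g \<in> Bij (strings q)"
  by (simp add: isom_rooted_def isom_def)

lemma isom_rooted_in_strings: "g \<in> isom_rooted q \<Longrightarrow> s \<in> strings q \<Longrightarrow> g s \<in> strings q"
  by (rule funcset_mem[OF Bij_imp_funcset[OF isom_rooted_Bij]])

lemma rooted_section_in_strings:
  assumes "g \<in> isom_rooted q" "w \<in> strings q" "u \<in> strings q"
  shows "rooted_section q g w u \<in> strings q"
proof -
  have "g w @ rooted_section q g w u \<in> strings q"
    using isom_rooted_in_strings[OF assms(1), of "w @ u"] rooted_section_append[OF assms] assms(2,3)
    by simp
  then show ?thesis by simp
qed

lemma rooted_section_Nil:
  assumes "g \<in> isom_rooted q"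
  shows "rooted_section q g [] = g"
proof (rule extensionalityI)
  show "rooted_section q g [] \<in> extensional (strings q)" by (simp add: rooted_section_def)
  show "g \<in> extensional (strings q)" using Bij_imp_extensional[OF isom_rooted_Bij[OF assms]] .
  show "rooted_section q g [] s = g s" if "s \<in> strings q" for s
    using that assms by (simp add: rooted_section_def isom_rooted_def)
qed

lemma rooted_section_compose:
  assumes f: "f \<in> isom_rooted q" and g: "g \<in> isom_rooted q" and w: "w \<in> strings q"
  shows "rooted_section q (compose (strings q) f g) w =
    compose (strings q) (rooted_section q f (g w)) (rooted_section q g w)"
proof (rule extensionalityI)
  show "rooted_section q (compose (strings q) f g) w \<in> extensional (strings q)"
    by (simp add: rooted_section_def)
  show "compose (strings q) (rooted_section q f (g w)) (rooted_section q g w) \<in> extensional (strings q)"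
    by (simp add: compose_def)
  fix u assume u: "u \<in> strings q"
  have wu: "w @ u \<in> strings q" using w u by simp
  have "f (g (w @ u)) = f (g w) @ rooted_section q f (g w) (rooted_section q g w u)"
    using rooted_section_append[OF g w u]
      rooted_section_append[OF f isom_rooted_in_strings[OF g w] rooted_section_in_strings[OF g w u]]
    by simp
  moreover have "rooted_section q (compose (strings q) f g) w u =
      drop (length (f (g w))) (f (g (w @ u)))"
    by (simp only: rooted_section_def restrict_apply compose_def u w wu if_True)
  ultimately show "rooted_section q (compose (strings q) f g) w u =
      compose (strings q) (rooted_section q f (g w)) (rooted_section q g w) u"
    using u by (simp add: compose_eq)
qed

text \<open>Since \<open>isom_rooted q\<close> is itself a subgroup of the group of all bijections,
  \<open>G\<close> is one too, and the rules for \<open>compose\<close> and \<open>inv_into\<close>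
  apply to it.\<close>

lemma self_similarD:
  assumes "self_similar q G"
  shows "G \<subseteq> isom_rooted q" "subgroup G (BijGroup (strings q))"
    and "\<And>g w. g \<in> G \<Longrightarrow> w \<in> strings q \<Longrightarrow> rooted_section q g w \<in> G"
proof -
  have sub: "subgroup G (BijGroup (strings q)\<lparr>carrier := isom_rooted q\<rparr>)"
    using assms by (simp add: self_similar_def group_on_def)
  show "G \<subseteq> isom_rooted q" using subgroup.subset[OF sub] by simp
  show "subgroup G (BijGroup (strings q))"
    by (rule group.incl_subgroup[OF group_BijGroup subgroup_isom_rooted sub])
  show "rooted_section q g w \<in> G" if "g \<in> G" "w \<in> strings q" for g w
    using assms that by (simp add: self_similar_def)
qed

text \<open>Transitivity on level 1 supplies \<open>k\<close> with \<open>k [i] = [j]\<close>, whose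
  section \<open>s\<close> at \<open>[i]\<close> may be wrong. Precomposing with an element that
  fixes \<open>[i]\<close> and has section \<open>s\<close>-inverse times \<open>h\<close> there
  corrects it.\<close>

lemma self_replicating_lift:
  assumes G: "self_replicating q G" and h: "h \<in> G" and ij: "i < q" "j < q"
  shows "\<exists>g\<in>G. g [i] = [j] \<and> rooted_section q g [i] = h"
proof -
  let ?S = "strings q"
  have ss: "self_similar q G" using G by (simp add: self_replicating_def)
  note iso = subsetD[OF self_similarD(1)[OF ss]] and grp = subgroup_BijGroupD[OF self_similarD(2)[OF ss]]
  have i: "[i] \<in> ?S" using ij by simp
  obtain k where k: "k \<in> G" "k [i] = [j]" using G ij unfolding self_replicating_def by blast
  define s where "s = rooted_section q k [i]"
  define t where "t = restrict (inv_into ?S s) ?S"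
  have s: "s \<in> G" unfolding s_def by (rule self_similarD(3)[OF ss k(1) i])
  have t: "t \<in> G" unfolding t_def by (rule grp(4)[OF s])
  have "compose ?S t h \<in> (\<lambda>g. rooted_section q g [i]) ` {g \<in> G. g [i] = [i]}"
    using G i grp(3)[OF t h] unfolding self_replicating_def by blast
  then obtain f where f: "f \<in> G" "f [i] = [i]" "rooted_section q f [i] = compose ?S t h" by force
  have hB: "h \<in> Bij ?S" using grp(1) h by blast
  have "rooted_section q (compose ?S k f) [i] = compose ?S s (compose ?S t h)"
    using rooted_section_compose[OF iso[OF k(1)] iso[OF f(1)] i] f by (simp add: s_def)
  also have "\<dots> = compose ?S (compose ?S s t) h"
    by (rule compose_assoc[OF Bij_imp_funcset[OF hB]])
  also have "compose ?S s t = restrict (\<lambda>x. x) ?S"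
    unfolding t_def using compose_restrict_inv_into grp(1) s by blast
  also have "compose ?S (restrict (\<lambda>x. x) ?S) h = h"
    by (rule Id_compose[OF Bij_imp_funcset[OF hB] Bij_imp_extensional[OF hB]])
  finally have "rooted_section q (compose ?S k f) [i] = h" .
  moreover have "compose ?S k f [i] = [j]" using i k f by (simp add: compose_def)
  ultimately show ?thesis using grp(3)[OF k(1) f(1)] by blast
qed

section \<open>Extending a prescribed section to the whole regular tree\<close>

lemma ancestor_cover:
  assumes "q > 0" "a \<in> verts q" "v \<in> verts q"
  shows "\<exists>k. \<exists>s\<in>strings q. v = foldl child (parent_ray a k) s"
proof -
  obtain k m where km: "parent_ray a k = parent_ray v m"
    using parent_rays_meet[OF assms] by blast
  show ?thesis
    using descendant_parent_ray[OF assms(3), of m, folded km] by (rule exI)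
qed

text \<open>The subtrees below the ancestors \<open>?U k\<close> of \<open>a\<close> increase and
  exhaust the tree. A map is built on each of them, to the subtree below the ancestor
  \<open>?W k\<close> of \<open>b\<close>, and the maps are glued.\<close>

lemma self_replicating_extension:
  assumes q: "q > 0" and G: "self_replicating q G" and h: "h \<in> G"
    and a: "a \<in> verts q" and b: "b \<in> verts q"
  shows "\<exists>x\<in>parent_isom q. x a = b \<and> reg_section q x a = h \<and> (\<forall>v\<in>verts q. reg_section q x v \<in> G)"
proof -
  have ss: "self_similar q G" using G by (simp add: self_replicating_def)
  let ?U = "parent_ray a" and ?W = "parent_ray b"
  define i where "i k = snd (?U k) (fst (?U k))" for k
  define j where "j k = snd (?W k) (fst (?W k))" for k
  have ij: "i k < q" "j k < q" for k
    unfolding i_def j_def by (intro last_symbol_less parent_ray_in_verts a b)+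
  \<comment> \<open>The element \<open>g n\<close> is to be the section at the \<open>n\<close>-th
    ancestor of \<open>a\<close>. Each one is lifted through the symbols \<open>i n\<close> and
    \<open>j n\<close> that lead from the next ancestors back down.\<close>
  have "\<exists>g. \<forall>n. (g n \<in> G \<and> (n = 0 \<longrightarrow> g n = h)) \<and>
      (g (Suc n) [i n] = [j n] \<and> rooted_section q (g (Suc n)) [i n] = g n)"
  proof (rule dependent_nat_choice)
    show "\<exists>x. x \<in> G \<and> (0 = 0 \<longrightarrow> x = h)" using h by blast
    show "\<exists>y. (y \<in> G \<and> (Suc n = 0 \<longrightarrow> y = h)) \<and> y [i n] = [j n] \<and> rooted_section q y [i n] = x"
      if "x \<in> G \<and> (n = 0 \<longrightarrow> x = h)" for x n
      using self_replicating_lift[OF G _ ij(1)[of n] ij(2)[of n], of x] that by auto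
  qed
  then obtain g where gG: "g n \<in> G" and g0: "g 0 = h" and gS: "g (Suc n) [i n] = [j n]"
    "rooted_section q (g (Suc n)) [i n] = g n" for n by metis
  have iso: "g k \<in> isom_rooted q" for k using gG self_similarD(1)[OF ss] by blast
  have gin: "g k s \<in> strings q" if "s \<in> strings q" for k s
    using isom_rooted_in_strings[OF iso that] .
  have Uv: "?U k \<in> verts q" and Wv: "?W k \<in> verts q" for k
    using parent_ray_in_verts a b by auto
  \<comment> \<open>\<open>D k\<close> is the subtree below \<open>?U k\<close>, and
    \<open>X k\<close> transports it by \<open>g k\<close> to the subtree below
    \<open>?W k\<close>.\<close>
  define D where "D k = foldl child (?U k) ` strings q" for k
  define X where "X k v = foldl child (?W k) (g k (phi (?U k) v))" for k v
  have Dv: "v \<in> verts q" if "v \<in> D k" for v k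
    using that foldl_child_in_verts[OF Uv] unfolding D_def by (elim imageE) simp
  have Uc: "?U k = child (?U (Suc k)) (i k)" for k
    unfolding i_def by (rule parent_ray_child[OF a])
  have Wc: "?W k = child (?W (Suc k)) (j k)" for k
    unfolding j_def by (rule parent_ray_child[OF b])
  have D_iff: "v \<in> D k \<longleftrightarrow> (\<exists>s\<in>strings q. v = foldl child (?U k) s)" for v k
    by (simp only: D_def image_iff)
  \<comment> \<open>Seen from one level higher, the string \<open>s\<close> becomes
    \<open>i k # s\<close>, which \<open>g (Suc k)\<close> sends to \<open>j k # g k s\<close>: the
    same vertex below \<open>?W k\<close>.\<close>
  have Dstep: "v \<in> D (Suc k) \<and> X (Suc k) v = X k v" if "v \<in> D k" for v k
  proof -
    from that[unfolded D_iff] obtain s where s: "s \<in> strings q" "v = foldl child (?U k) s"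
      by (rule bexE)
    have iks: "i k # s \<in> strings q" using s(1) ij(1) by simp
    have v': "v = foldl child (?U (Suc k)) (i k # s)"
      unfolding foldl_Cons Uc[symmetric] by (rule s(2))
    have "g (Suc k) ([i k] @ s) = [j k] @ g k s"
      using rooted_section_append[OF iso, of "[i k]" s "Suc k"] gS[of k] s(1) ij(1)[of k] by simp
    then have "X (Suc k) v = foldl child (child (?W (Suc k)) (j k)) (g k s)"
      unfolding X_def v' phi_foldl_child by simp
    also have "\<dots> = X k v"
      unfolding X_def s(2) phi_foldl_child Wc[symmetric] ..
    finally have "X (Suc k) v = X k v" .
    moreover have "v \<in> D (Suc k)" unfolding D_iff using v' iks by (rule bexI)
    ultimately show ?thesis by simp
  qed
  have mono: "v \<in> D m \<and> X m v = X k v" if "v \<in> D k" "k \<le> m" for v k m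
    using that(2)
  proof (induction m rule: dec_induct)
    case base
    then show ?case using that(1) by simp
  next
    case (step m)
    then show ?case using Dstep[of v m] by simp
  qed
  have cover: "\<exists>k. v \<in> D k" if "v \<in> verts q" for v
    using ancestor_cover[OF q a that] by (simp only: D_iff)
  \<comment> \<open>The least level is only a canonical choice; by \<open>mono\<close> every level
    whose subtree contains \<open>v\<close> gives the same value.\<close>
  define x where "x = (\<lambda>v\<in>verts q. X (LEAST k. v \<in> D k) v)"
  have xD: "x v = X k v" if "v \<in> D k" for v k
  proof -
    let ?l = "LEAST k. v \<in> D k"
    have "v \<in> D ?l" "?l \<le> k" using that by (rule LeastI, rule Least_le)
    then have "X k v = X ?l v" using mono[of v ?l k] by simp
    then show ?thesis using Dv[OF that] by (simp add: x_def)
  qed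
  have xf: "x (foldl child (?U k) s) = foldl child (?W k) (g k s)" if "s \<in> strings q" for k s
  proof -
    have "foldl child (?U k) s \<in> D k" unfolding D_iff using refl that by (rule bexI)
    then show ?thesis by (simp only: xD X_def phi_foldl_child)
  qed
  have common: "\<exists>k. \<exists>s\<in>strings q. \<exists>t\<in>strings q. u = foldl child (?U k) s \<and> v = foldl child (?U k) t"
    if uv: "u \<in> verts q" "v \<in> verts q" for u v
  proof -
    obtain k m where "u \<in> D k" "v \<in> D m" using cover[OF uv(1)] cover[OF uv(2)] by blast
    then have "u \<in> D (max k m)" "v \<in> D (max k m)"
      using mono[of u k "max k m"] mono[of v m "max k m"] by simp_all
    then obtain s t where "s \<in> strings q" "u = foldl child (?U (max k m)) s"
      "t \<in> strings q" "v = foldl child (?U (max k m)) t"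
      unfolding D_iff by (elim bexE)
    then show ?thesis by blast
  qed
  have bij: "bij_betw (g k) (strings q) (strings q)" for k
    using isom_rooted_Bij[OF iso] by (simp add: Bij_def)
  have "inj_on x (verts q)"
  proof (rule inj_onI)
    fix u v assume uv: "u \<in> verts q" "v \<in> verts q" "x u = x v"
    from common[OF uv(1,2)] obtain k s t where st: "s \<in> strings q" "t \<in> strings q"
      "u = foldl child (?U k) s" "v = foldl child (?U k) t" by (elim exE bexE conjE)
    then have "g k s = g k t" using uv(3) xf foldl_child_inject by simp
    then have "s = t" using inj_onD[OF bij_betw_imp_inj_on[OF bij]] st(1,2) by blast
    then show "u = v" using st by simp
  qed
  \<comment> \<open>Surjectivity uses that the subtrees below the ancestors of \<open>b\<close> also
    exhaust the tree and that each \<open>g k\<close> is onto.\<close>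
  moreover have "x ` verts q = verts q"
  proof (intro equalityI subsetI)
    fix v assume "v \<in> x ` verts q"
    then obtain u where u: "u \<in> verts q" "v = x u" by blast
    from common[OF u(1) u(1)] obtain k s where "s \<in> strings q" "u = foldl child (?U k) s"
      by (elim exE bexE conjE)
    then show "v \<in> verts q" using u(2) xf foldl_child_in_verts[OF Wv gin] by simp
  next
    fix v assume "v \<in> verts q"
    from ancestor_cover[OF q b this] obtain k t where t: "t \<in> strings q" "v = foldl child (?W k) t"
      by (elim exE bexE)
    then have "t \<in> g k ` strings q" using bij_betw_imp_surj_on[OF bij, of k] by simp
    then obtain s where s: "t = g k s" "s \<in> strings q" by (rule imageE)
    then have "v = x (foldl child (?U k) s)" using t(2) xf[OF s(2)] by simp
    then show "v \<in> x ` verts q" using foldl_child_in_verts[OF Uv s(2)] by (rule image_eqI)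
  qed
  ultimately have xB: "x \<in> Bij (verts q)" by (simp add: Bij_def bij_betw_def x_def)
  \<comment> \<open>Below a common ancestor \<open>?U k\<close> the string of \<open>v\<close> has
    one symbol more than that of its parent, and \<open>g k\<close> preserves this relation.\<close>
  have "x (parent v) = parent (x v)" if v: "v \<in> verts q" for v
  proof -
    from common[OF parent_in_verts[OF v] v]
    obtain k s where s: "s \<in> strings q" "parent v = foldl child (?U k) s"
      by (elim exE bexE conjE)
    let ?l = "snd v (fst v)"
    have l: "?l < q" using last_symbol_less[OF v] .
    have sl: "s @ [?l] \<in> strings q" using s(1) l by simp
    have "foldl child (?U k) (s @ [?l]) = v" using s(2) child_last_parent[OF v] by simp
    moreover obtain m where "g k (s @ [?l]) = g k s @ [m]"
      using isom_rooted_snoc[OF iso[of k] s(1) l] by blast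
    ultimately have "x v = child (foldl child (?W k) (g k s)) m" using xf[OF sl, of k] by simp
    then have "parent (x v) = foldl child (?W k) (g k s)"
      using parent_child[OF foldl_child_in_verts[OF Wv gin[OF s(1)]]] by simp
    then show ?thesis using xf s by simp
  qed
  then have x: "x \<in> parent_isom q" using xB by (simp add: parent_isom_def)
  \<comment> \<open>Every vertex lies below some \<open>?U k\<close>, so every section of
    \<open>x\<close> is a section of some \<open>g k\<close>, and self-similarity puts it in
    \<open>G\<close>.\<close>
  have sec: "reg_section q x (foldl child (?U k) s) = rooted_section q (g k) s"
    if s: "s \<in> strings q" for k s
  proof (rule extensionalityI[OF reg_section_extensional])
    show "rooted_section q (g k) s \<in> extensional (strings q)" by (simp add: rooted_section_def)
    show "reg_section q x (foldl child (?U k) s) t = rooted_section q (g k) s t"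
      if t: "t \<in> strings q" for t
    proof (rule reg_section_eqI[OF foldl_child_in_verts[OF Uv s] t])
      have "x (foldl child (?U k) (s @ t)) = foldl child (?W k) (g k s @ rooted_section q (g k) s t)"
        using xf[of "s @ t" k] s t rooted_section_append[OF iso s t] by simp
      then show "x (foldl child (foldl child (?U k) s) t) =
          foldl child (x (foldl child (?U k) s)) (rooted_section q (g k) s t)"
        using xf[OF s] by simp
    qed
  qed
  have "reg_section q x v \<in> G" if v: "v \<in> verts q" for v
  proof -
    from common[OF v v] obtain k s where s: "s \<in> strings q" "v = foldl child (?U k) s"
      by (elim exE bexE conjE)
    then show ?thesis using sec self_similarD(3)[OF ss gG] by simp
  qed
  moreover have "x a = b" using xf[of "[]" 0] iso[of 0] by (simp add: parent_ray_0 isom_rooted_def)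
  moreover have "reg_section q x a = h"
    using sec[of "[]" 0] rooted_section_Nil[OF iso[of 0]] by (simp add: parent_ray_0 g0)
  ultimately show ?thesis using x by blast
qed

section \<open>The scale group\<close>

text \<open>With \<open>G = Phat\<close> this is the scale group \<open>P\<close> of the
  theorem.\<close>

definition section_group :: "nat \<Rightarrow> (nat list \<Rightarrow> nat list) set \<Rightarrow> (vertex \<Rightarrow> vertex) set" where
  "section_group q G = {x \<in> parent_isom q. \<forall>v\<in>verts q. reg_section q x v \<in> G}"

lemma section_group_subset: "section_group q G \<subseteq> isom_reg q"
  using parent_isom_subset_isom by (auto simp: section_group_def)

text \<open>Closure under products is the cocycle identity. For the inverse \<open>y\<close> of
  \<open>x\<close>, the section at \<open>v\<close> is the inverse of the section of
  \<open>x\<close> at \<open>y v\<close>.\<close>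

lemma subgroup_section_group:
  assumes G: "subgroup G (BijGroup (strings q))"
  shows "subgroup (section_group q G) (BijGroup (verts q))"
proof (rule subgroup_BijGroupI)
  note grp = subgroup_BijGroupD[OF G] and par = subgroup_BijGroupD[OF subgroup_parent_isom[of q]]
  show "section_group q G \<subseteq> Bij (verts q)" by (auto simp: section_group_def parent_isom_def)
  show "restrict (\<lambda>x. x) (verts q) \<in> section_group q G"
    using par(2) grp(2) by (simp add: section_group_def reg_section_id)
  show "compose (verts q) x y \<in> section_group q G"
    if "x \<in> section_group q G" "y \<in> section_group q G" for x y
  proof -
    have x: "x \<in> parent_isom q" "\<forall>v\<in>verts q. reg_section q x v \<in> G"
      and y: "y \<in> parent_isom q" "\<forall>v\<in>verts q. reg_section q y v \<in> G"
      using that by (simp_all add: section_group_def)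
    have "reg_section q (compose (verts q) x y) v \<in> G" if v: "v \<in> verts q" for v
      unfolding reg_section_compose[OF x(1) y(1) v]
      using x(2) y(2) v parent_isom_in_verts[OF y(1) v] by (intro grp(3)) simp_all
    then show ?thesis using par(3)[OF x(1) y(1)] by (simp add: section_group_def)
  qed
  show "restrict (inv_into (verts q) x) (verts q) \<in> section_group q G"
    if "x \<in> section_group q G" for x
  proof -
    have x: "x \<in> parent_isom q" "\<forall>v\<in>verts q. reg_section q x v \<in> G"
      using that by (simp_all add: section_group_def)
    define y where "y = restrict (inv_into (verts q) x) (verts q)"
    have y: "y \<in> parent_isom q" unfolding y_def by (rule par(4)[OF x(1)])
    have img: "x ` verts q = verts q" using x(1) by (simp add: parent_isom_def Bij_def bij_betw_def)
    have "reg_section q y v \<in> G" if v: "v \<in> verts q" for v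
    proof -
      have w: "y v \<in> verts q" "x (y v) = v"
        using v img parent_isom_in_verts[OF y v] by (simp_all add: y_def f_inv_into_f)
      have "compose (strings q) (reg_section q y v) (reg_section q x (y v)) = restrict (\<lambda>s. s) (strings q)"
        using reg_section_inverse(2)[OF x(1) w(1)] unfolding y_def[symmetric] w(2) .
      then have "reg_section q y v = restrict (inv_into (strings q) (reg_section q x (y v))) (strings q)"
        using isom_rooted_Bij[OF reg_section_in_isom_rooted[OF x(1) w(1)]]
          isom_rooted_Bij[OF reg_section_in_isom_rooted[OF y v]]
        by (intro restrict_inv_into_unique)
      then show ?thesis using grp(4)[of "reg_section q x (y v)"] x(2) w(1) by simp
    qed
    then show ?thesis using y unfolding y_def[symmetric] by (simp add: section_group_def)
  qed
qed

lemma isom_subset_PiE: "isom V E \<subseteq> V \<rightarrow>\<^sub>E V"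
proof
  fix g assume "g \<in> isom V E"
  then have "g \<in> Bij V" by (simp add: isom_def)
  then show "g \<in> V \<rightarrow>\<^sub>E V" using Bij_imp_funcset Bij_imp_extensional by (auto simp: PiE_def)
qed

text \<open>Each defining condition is tested on finite sets: commuting with \<open>parent\<close>
  on two vertices, and membership of a section in the closed set \<open>G\<close> on finitely many
  strings.\<close>

lemma closedin_section_group:
  assumes G: "closedin (pointwise_topology (strings q) (isom_rooted q)) G"
  shows "closedin (pointwise_topology (verts q) (isom_reg q)) (section_group q G)"
proof (rule closedin_pointwise_topologyI[OF section_group_subset isom_subset_PiE])
  fix g assume g: "g \<in> isom_reg q"
    and agree: "\<And>F. finite F \<Longrightarrow> F \<subseteq> verts q \<Longrightarrow> \<exists>h\<in>section_group q G. \<forall>a\<in>F. h a = g a"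
  have "g (parent v) = parent (g v)" if v: "v \<in> verts q" for v
  proof -
    obtain h where "h \<in> section_group q G" "h v = g v" "h (parent v) = g (parent v)"
      using agree[of "{v, parent v}"] v parent_in_verts[OF v] by auto
    then show ?thesis using v by (simp add: section_group_def parent_isom_def)
  qed
  then have gp: "g \<in> parent_isom q" using g by (simp add: parent_isom_def isom_def)
  have "reg_section q g v \<in> G" if v: "v \<in> verts q" for v
  proof (rule closedin_pointwise_topologyD[OF G])
    show iso: "reg_section q g v \<in> isom_rooted q" by (rule reg_section_in_isom_rooted[OF gp v])
    then have "reg_section q g v \<in> isom (strings q) (rooted_edges q)"
      by (simp add: isom_rooted_def)
    then show "reg_section q g v \<in> strings q \<rightarrow>\<^sub>E strings q"
      by (rule subsetD[OF isom_subset_PiE])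
    fix F assume F: "finite F" "F \<subseteq> strings q"
    \<comment> \<open>The vertex \<open>v\<close> itself is included so that \<open>h\<close> and
      \<open>g\<close> have sections at \<open>v\<close> read off from the same image
      vertex.\<close>
    have "insert v (foldl child v ` F) \<subseteq> verts q"
      using v foldl_child_in_verts[OF v] F(2) by (intro insert_subsetI image_subsetI) (simp_all add: subsetD)
    then obtain h where h: "h \<in> section_group q G" "h v = g v" "\<forall>s\<in>F. h (foldl child v s) = g (foldl child v s)"
      using agree[of "insert v (foldl child v ` F)"] F(1) by auto
    have "\<forall>s\<in>F. reg_section q h v s = reg_section q g v s"
      using h F(2) v by (simp add: reg_section_append subset_iff)
    moreover have "reg_section q h v \<in> G" using h(1) v by (simp add: section_group_def)
    ultimately show "\<exists>h\<in>G. \<forall>a\<in>F. h a = reg_section q g v a" by (intro bexI)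
  qed
  then show "g \<in> section_group q G" using gp by (simp add: section_group_def)
qed

text \<open>Transitivity on vertices is the extension property with the identity as prescribed
  section.\<close>

lemma section_group_in_scale_groups:
  assumes q: "q > 0" and G: "self_replicating q G"
    and cl: "closedin (pointwise_topology (strings q) (isom_rooted q)) G"
  shows "section_group q G \<in> scale_groups q"
proof -
  have ss: "self_similar q G" using G by (simp add: self_replicating_def)
  note G_sub = self_similarD(2)[OF ss]
  have "subgroup (section_group q G) (group_on (verts q) (isom_reg q))"
    unfolding group_on_def
    by (rule group.subgroup_incl[OF group_BijGroup subgroup_section_group[OF G_sub] subgroup_isom
          section_group_subset])
  moreover have "fixes_end x (omega q)" if "x \<in> section_group q G" for x
    using parent_isom_fixes_omega[OF q] that by (simp add: section_group_def)
  moreover have "\<exists>x\<in>section_group q G. x u = v" if "u \<in> verts q" "v \<in> verts q" for u v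
    using self_replicating_extension[OF q G subgroup_BijGroupD(2)[OF G_sub] that]
    unfolding section_group_def by blast
  ultimately show ?thesis using closedin_section_group[OF cl] by (simp add: scale_groups_def)
qed

section \<open>Compatibility of the standard labelling\<close>

lemma std_label_parent: "std_label q v (parent v) = q"
  by (simp add: std_label_def)

lemma std_label_child: "std_label q v (child v j) = j"
proof -
  have "child v j \<noteq> parent v" using fst_child[of v j] fst_parent[of v] by auto
  then show ?thesis by (cases v) (simp add: std_label_def)
qed

text \<open>An element with trivial section at \<open>u\<close> copies strings unchanged from the
  subtree of \<open>u\<close> to that of \<open>v\<close>, so it preserves the last symbols, which
  are the labels of the downward edges.\<close>

lemma compatible_std_label:
  assumes q: "q > 0" and G: "self_replicating q G"
  shows "compatible q (std_label q) (section_group q G)"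
  unfolding compatible_def
proof (intro conjI ballI)
  show "std_label q v (parent v) = q" for v by (rule std_label_parent)
  \<comment> \<open>The zero strings form the bi-infinite path labelled 0.\<close>
  define p :: "int \<Rightarrow> vertex" where "p n = (n, restrict (\<lambda>_. 0) {..n})" for n
  have p1: "p n \<in> verts q" for n using q by (simp add: p_def verts_iff)
  have p2: "p n = parent (p (n + 1))" for n by (simp add: p_def Int_absorb1)
  have p3: "std_label q (p n) (p (n + 1)) = 0" for n by (simp add: p_def std_label_def)
  show "\<exists>p :: int \<Rightarrow> vertex.
      \<forall>n. p n \<in> verts q \<and> p n = parent (p (n + 1)) \<and> std_label q (p n) (p (n + 1)) = 0"
    by (intro exI[of _ p] allI conjI p1 p2 p3)
  fix u v assume u: "u \<in> verts q" and v: "v \<in> verts q"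
  have ss: "self_similar q G" using G by (simp add: self_replicating_def)
  obtain x where x: "x \<in> parent_isom q" "x u = v" "reg_section q x u = restrict (\<lambda>s. s) (strings q)"
    and xG: "x \<in> section_group q G"
    using self_replicating_extension[OF q G subgroup_BijGroupD(2)[OF self_similarD(2)[OF ss]] u v]
    unfolding section_group_def by blast
  have xs: "x (foldl child u s) = foldl child v s" if "s \<in> strings q" for s
    using parent_isom_foldl_child(2)[OF x(1) u that] x(2,3) that by simp
  have "std_label q (x a) (x b) = std_label q a b"
    if sub: "a \<in> subtree q u" "b \<in> subtree q u" and edge: "{a, b} \<in> edges q" for a b
  proof -
    obtain s t where s: "s \<in> strings q" "a = foldl child u s" and t: "t \<in> strings q" "b = foldl child u t"
      using sub unfolding subtree_eq[OF u] by (elim imageE)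
    have ab: "a \<in> verts q" "b \<in> verts q" using s t foldl_child_in_verts[OF u] by simp_all
    then consider "b = parent a" | "a = parent b" using edge edge_iff[OF ab] by blast
    then show ?thesis
    proof cases
      case 1
      then have "x b = parent (x a)" using x(1) ab(1) by (simp add: parent_isom_def)
      then show ?thesis using 1 by (simp add: std_label_parent)
    next
      case 2
      let ?j = "snd b (fst b)"
      have b: "b = child a ?j" using child_last_parent[OF ab(2)] 2 by simp
      have "s @ [?j] \<in> strings q" using s(1) last_symbol_less[OF ab(2)] by simp
      then have "x (child a ?j) = child (x a) ?j"
        using xs[of "s @ [?j]"] xs[OF s(1)] s(2) by simp
      then have "x b = child (x a) ?j" by (simp only: b[symmetric])
      then have "std_label q (x a) (x b) = ?j" by (simp only: std_label_child)
      also have "\<dots> = std_label q a b" using std_label_child[of q a ?j] by (simp only: b[symmetric])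
      finally show ?thesis .
    qed
  qed
  then show "\<exists>x\<in>section_group q G. x u = v \<and> (\<forall>a\<in>subtree q u. \<forall>b\<in>subtree q u.
      {a, b} \<in> edges q \<longrightarrow> std_label q (x a) (x b) = std_label q a b)"
    using xG x(2) by blast
qed

theorem proposition3p9:
  fixes q :: nat and Phat :: "(nat list \<Rightarrow> nat list) set"
  assumes "q \<ge> 2"
    and "self_replicating q Phat"
    and "closedin (pointwise_topology (strings q) (isom_rooted q)) Phat"
  shows "\<exists>P\<in>scale_groups q.
    compatible q (std_label q) P \<and>
    (\<forall>v\<in>verts q. Phat = {reg_section q x v | x. x \<in> P})"
proof (intro bexI conjI ballI)
  have q: "q > 0" using assms(1) by simp
  show "section_group q Phat \<in> scale_groups q"
    by (rule section_group_in_scale_groups[OF q assms(2,3)])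
  show "compatible q (std_label q) (section_group q Phat)"
    by (rule compatible_std_label[OF q assms(2)])
  fix v assume v: "v \<in> verts q"
  show "Phat = {reg_section q x v | x. x \<in> section_group q Phat}"
  proof (intro equalityI subsetI)
    \<comment> \<open>The extension property with source and target both equal to \<open>v\<close>
      realises any \<open>h\<close> as a section at \<open>v\<close>.\<close>
    fix h assume "h \<in> Phat"
    then obtain x where "x \<in> section_group q Phat" "reg_section q x v = h"
      using self_replicating_extension[OF q assms(2) _ v v] unfolding section_group_def by blast
    then show "h \<in> {reg_section q x v | x. x \<in> section_group q Phat}" by blast
  next
    fix h assume "h \<in> {reg_section q x v | x. x \<in> section_group q Phat}"
    then show "h \<in> Phat" using v by (auto simp: section_group_def)
  qed
qed

end
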